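(* Let $q$ be a prime power and let $n,r,h$ be positive integers with $h\le r-1$ and $h+1\mid rn$. Let $L_U$ be a maximum $h$-scattered $\mathbb{F}_q$-linear set in $\Lambda=\mathrm{PG}(r-1,q^n)$, let $N=|L_U|=\frac{q^{rn/(h+1)}-1}{q-1}$, and let $\mathcal{C}_{L_U}$ be the associated $\mathbb{F}_{q^n}$-linear code of length $N$ and dimension $r$. Then $\mathcal{C}_{L_U}$ is a code with at most $h+1$ (nonzero Hamming) weights. In particular, the weights of $\mathcal{C}_{L_U}$ are exactly the values $$N-\theta_{i-1},$$ where $i$ runs over all the weights $w_{L_U}(\mathcal{H})$ attained by the hyperplanes $\mathcal{H}$ of $\Lambda$ with respect to $L_U$.
   Context: Notation: $\theta_i=\frac{q^{i+1}-1}{q-1}$ for $i\ge 0$, and $\theta_{-1}=0$. Linear sets: Let $V$ be an $r$-dimensional $\mathbb{F}_{q^n}$-vector space and $\Lambda=\mathrm{PG}(V,\mathbb{F}_{q^n})=\mathrm{PG}(r-1,q^n)$. An $\mathbb{F}_q$-linear set of rank $k$ in $\Lambda$ is a point set $L_U=\{\langle u\rangle_{\mathbb{F}_{q^n}} : u\in U\setminus\{0\}\}$, where $U$ is a $k$-dimensional $\mathbb{F}_q$-subspace of $V$. For a projective subspace $\Omega=\mathrm{PG}(W,\mathbb{F}_{q^n})$ of $\Lambda$, its weight in $L_U$ is $w_{L_U}(\Omega)=\dim_{\mathbb{F}_q}(W\cap U)$. $L_U$ is scattered if all of its points have weight one (equivalently $|L_U|=\theta_{k-1}$). $L_U$ is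 $h$-scattered if $\langle L_U\rangle=\Lambda$ and every $(h-1)$-dimensional projective subspace $\Omega$ of $\Lambda$ satisfies $w_{L_U}(\Omega)\le h$. A maximum $h$-scattered linear set is an $h$-scattered $\mathbb{F}_q$-linear set of rank $\frac{rn}{h+1}$. Code: Write $L_U=\{\langle (g_{1i},\ldots,g_{ri})\rangle_{\mathbb{F}_{q^n}} : i\in\{1,\ldots,N\}\}$ with $N=|L_U|$ (one representative vector per point). $\mathcal{C}_{L_U}$ is the $\mathbb{F}_{q^n}$-linear code whose generator matrix $G$ is the $(r\times N)$-matrix having these vectors as columns, i.e. $\mathcal{C}_{L_U}=\{\mathbf{x}G:\mathbf{x}\in\mathbb{F}_{q^n}^r\}$. The weights of a code are the Hamming weights (numbers of nonzero entries) of its nonzero codewords. *)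

theory Defs
  imports "HOL-Analysis.Analysis"
begin

text \<open>
  The field $F_q$ is a finite field type \<open>'k\<close>, $F_{q^n}$ is a finite field type \<open>'a\<close>, and the
  extension is an embedding \<open>\<iota> :: 'k \<Rightarrow> 'a\<close>. The space $V$ is \<open>'a ^ 'r\<close>; notions over $F_{q^n}$
  are those of the library's interpretation \<open>vec\<close>. Projective subspaces and points are represented
  by the corresponding vector subspaces.
\<close>

definition field_embedding :: "('k::field \<Rightarrow> 'a::field) \<Rightarrow> bool" where
  "field_embedding \<iota> \<longleftrightarrow>
     \<iota> 1 = 1 \<and> (\<forall>x y. \<iota> (x + y) = \<iota> x + \<iota> y) \<and> (\<forall>x y. \<iota> (x * y) = \<iota> x * \<iota> y)"

definition Fq_scale :: "('k::field \<Rightarrow> 'a::field) \<Rightarrow> 'k \<Rightarrow> 'a ^ 'r \<Rightarrow> 'a ^ 'r" where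
  "Fq_scale \<iota> c v = \<iota> c *s v"

text \<open>
  The two locale constants below are meaningful because \<open>Fq_scale \<iota>\<close> makes \<open>'a ^ 'r\<close> a vector
  space over \<open>'k\<close> as soon as \<open>\<iota>\<close> is a field embedding.
\<close>

lemma vector_space_Fq_scale:
  assumes "field_embedding \<iota>"
  shows "vector_space (Fq_scale \<iota>)"
  using assms unfolding field_embedding_def
  by unfold_locales
    (auto simp: Fq_scale_def vec_eq_iff algebra_simps)

definition Fq_subspace :: "('k::field \<Rightarrow> 'a::field) \<Rightarrow> ('a ^ 'r) set \<Rightarrow> bool" where
  "Fq_subspace \<iota> U \<longleftrightarrow> module.subspace (Fq_scale \<iota>) U"

definition Fq_dim :: "('k::field \<Rightarrow> 'a::field) \<Rightarrow> ('a ^ 'r) set \<Rightarrow> nat" where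
  "Fq_dim \<iota> U = vector_space.dim (Fq_scale \<iota>) U"

text \<open>Projective dimension is vector space dimension minus one; the empty subspace has dimension -1.\<close>

definition proj_subspace :: "int \<Rightarrow> ('a::field ^ 'r) set \<Rightarrow> bool" where
  "proj_subspace d W \<longleftrightarrow> vec.subspace W \<and> int (vec.dim W) = d + 1"

definition hyperplane :: "('a::field ^ 'r) set \<Rightarrow> bool" where
  "hyperplane W \<longleftrightarrow> proj_subspace (int CARD('r) - 2) W"

definition linear_set :: "('a::field ^ 'r) set \<Rightarrow> ('a ^ 'r) set set" where
  "linear_set U = {vec.span {u} | u. u \<in> U - {0}}"

definition linear_set_weight ::
  "('k::field \<Rightarrow> 'a::field) \<Rightarrow> ('a ^ 'r) set \<Rightarrow> ('a ^ 'r) set \<Rightarrow> nat" where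
  "linear_set_weight \<iota> U W = Fq_dim \<iota> (W \<inter> U)"

definition h_scattered ::
  "('k::field \<Rightarrow> 'a::field) \<Rightarrow> nat \<Rightarrow> ('a ^ 'r) set \<Rightarrow> bool" where
  "h_scattered \<iota> h U \<longleftrightarrow>
     Fq_subspace \<iota> U \<and>
     vec.span (\<Union> (linear_set U)) = UNIV \<and>
     (\<forall>W. proj_subspace (int h - 1) W \<longrightarrow> linear_set_weight \<iota> U W \<le> h)"

text \<open>The argument \<open>n\<close> is the degree of the field extension; the rank is $rn/(h+1)$.\<close>

definition maximum_h_scattered ::
  "('k::field \<Rightarrow> 'a::field) \<Rightarrow> nat \<Rightarrow> nat \<Rightarrow> ('a ^ 'r) set \<Rightarrow> bool" where
  "maximum_h_scattered \<iota> n h U \<longleftrightarrow>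
     h_scattered \<iota> h U \<and> real (Fq_dim \<iota> U) = real (CARD('r) * n) / real (h + 1)"

definition theta :: "nat \<Rightarrow> int \<Rightarrow> real" where
  "theta q i = (real q ^ nat (i + 1) - 1) / (real q - 1)"

text \<open>
  The columns of \<open>G\<close>, indexed by a finite type \<open>'c\<close> (whose cardinality is then $|L_U|$), consist of
  exactly one representative vector for each point of the linear set.
\<close>

definition generator_matrix_of :: "('a::field ^ 'r) set \<Rightarrow> 'a ^ 'c ^ 'r \<Rightarrow> bool" where
  "generator_matrix_of U G \<longleftrightarrow>
     bij_betw (\<lambda>i. vec.span {column i G}) UNIV (linear_set U)"

definition code_of :: "'a::field ^ 'c ^ 'r \<Rightarrow> ('a ^ 'c) set" where
  "code_of G = {x v* G | x. True}"

definition hamming_weight :: "'a::field ^ 'c \<Rightarrow> nat" where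
  "hamming_weight c = card {i. c $ i \<noteq> 0}"

definition code_weights :: "('a::field ^ 'c) set \<Rightarrow> nat set" where
  "code_weights C = hamming_weight ` (C - {0})"

end

theory Submission
  imports Defs
begin

text \<open>
  The entry of the codeword \<open>x v* G\<close> at a point of the linear set is the scalar product of \<open>x\<close> with a
  representative of that point, so it is zero exactly if the point lies in the hyperplane orthogonal
  to \<open>x\<close>. Since \<open>U\<close> spans the space, only \<open>x = 0\<close> gives the codeword 0 (\<open>encoding_inj\<close>). So the
  nonzero codewords correspond to the hyperplanes with a chosen normal vector, and the Hamming weight
  is \<open>N\<close> minus the number of points in the hyperplane (\<open>hamming_weight_codeword\<close>). As \<open>h\<close> is
  positive, \<open>U\<close> is scattered (\<open>h_scattered_point_in_Fq_line\<close>), so a hyperplane of weight \<open>i\<close> contains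
  $\theta_{i-1} = (q^i - 1)/(q - 1)$ points (\<open>card_linear_set\<close>). This describes the set of weights.

  The bound \<open>h + 1\<close> on their number holds since the hyperplanes have at most \<open>h + 1\<close> different weights
  (\<open>maximum_h_scattered_weight_set\<close>). Let $k = rn/(h+1)$ be the rank of \<open>U\<close>, and let \<open>T\<close> be the set of
  all scalar products of \<open>x\<close> with elements of \<open>U\<close>, an $F_q$-subspace of $F_{q^n}$ of some dimension
  \<open>t\<close>. The hyperplane orthogonal to \<open>x\<close> has weight \<open>k - t\<close>, and \<open>t \<le> n\<close>. It remains to see that
  \<open>t \<ge> n - h\<close>, which says that the rank metric code of the maps that the vectors \<open>x\<close> induce on \<open>U\<close> is
  an MRD code; the argument is the duality of MRD codes in elementary terms.

  Because \<open>U\<close> is \<open>h\<close>-scattered, at most \<open>h + 1\<close> vectors of \<open>U\<close> that are independent over $F_q$ are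
  also independent over $F_{q^n}$ (\<open>h_scattered_independent\<close>). So for $a_0, \ldots, a_h$ in $F_{q^n}$
  that are independent over $F_q$, the sum of the subspaces $a_j U$ is direct. It has $q^{k(h+1)}$
  elements, which is $q^{rn}$ by the maximality of the rank, so it is the whole space
  (\<open>maximum_h_scattered_decomposition\<close>). Fix a nonzero $F_q$-linear functional \<open>\<tau>\<close> on $F_{q^n}$. If
  \<open>t\<close> were at most \<open>n - h - 1\<close>, then the space of all \<open>a\<close> such that \<open>\<tau>\<close> vanishes on \<open>a T\<close> would have
  dimension at least \<open>h + 1\<close>, and the $a_j$ could be chosen from it
  (\<open>ex_independent_annihilators\<close>). But then \<open>\<tau>\<close> would vanish on the sum of the $a_j T$, that is, on
  the scalar products of \<open>x\<close> with all vectors, and these fill $F_{q^n}$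
  (\<open>maximum_h_scattered_image_ge\<close>).
\<close>

section \<open>Finite fields and counting\<close>

lemma card_finite_field: "1 < CARD('k::{finite,field})"
  using card_mono[of UNIV "{0, 1::'k}"] by simp

lemma vector_space_field_embedding:
  assumes "field_embedding \<iota>"
  shows "vector_space (\<lambda>c x. \<iota> c * x)"
  using assms unfolding field_embedding_def by unfold_locales (auto simp: algebra_simps)

lemma field_embedding_eq_0_iff:
  assumes "field_embedding \<iota>"
  shows "\<iota> c = 0 \<longleftrightarrow> c = 0"
proof -
  interpret vector_space "\<lambda>c x. \<iota> c * x" by (rule vector_space_field_embedding) fact
  show ?thesis using scale_eq_0_iff[of c 1] by simp
qed

text \<open>
  Every nonempty fibre of \<open>f\<close> on \<open>S\<close> is a coset of \<open>K\<close>. Asking for this, rather than for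
  additivity of \<open>f\<close>, leaves the codomain without structure, so that \<open>f\<close> may be a family of
  functionals, as in \<open>ex_independent_annihilators\<close>.
\<close>

lemma card_eq_card_image_times_card_fibre:
  fixes f :: "'x::group_add \<Rightarrow> 'y"
  assumes "finite S" and "\<And>x y. x \<in> S \<Longrightarrow> y \<in> S \<Longrightarrow> x + y \<in> S" and "K \<subseteq> S"
    and fibres: "\<And>x y. x \<in> S \<Longrightarrow> y \<in> S \<Longrightarrow> f x = f y \<longleftrightarrow> - y + x \<in> K"
  shows "card S = card (f ` S) * card K"
proof -
  have "card S = (\<Sum>y\<in>f ` S. card {x \<in> S. f x = y})"
    using sum.image_gen[OF assms(1), of "\<lambda>_. 1" f] by (simp only: card_eq_sum)
  also have "\<dots> = (\<Sum>y\<in>f ` S. card K)"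
  proof (rule sum.cong)
    fix y assume "y \<in> f ` S"
    then obtain x0 where x0: "x0 \<in> S" "y = f x0" by blast
    have "{x \<in> S. f x = y} = (+) x0 ` K"
    proof (intro equalityI subsetI)
      fix x assume "x \<in> {x \<in> S. f x = y}"
      then have "- x0 + x \<in> K" using fibres[of x x0] x0 by simp
      then show "x \<in> (+) x0 ` K" by (rule rev_image_eqI) (simp add: add.assoc[symmetric])
    next
      fix x assume "x \<in> (+) x0 ` K"
      then obtain z where z: "z \<in> K" "x = x0 + z" by blast
      then have "x \<in> S" using assms(2,3) x0(1) by blast
      then show "x \<in> {x \<in> S. f x = y}"
        using fibres[of x x0] x0 z by (simp add: add.assoc[symmetric])
    qed
    then show "card {x \<in> S. f x = y} = card K" by (simp add: card_image)
  qed simp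
  finally show ?thesis by simp
qed

lemma card_span_independent:
  fixes scale :: "'k::{finite,field} \<Rightarrow> 'b::ab_group_add \<Rightarrow> 'b"
  assumes "vector_space scale" and "finite B" and "\<not> module.dependent scale B"
  shows "card (module.span scale B) = CARD('k) ^ card B"
proof -
  interpret vector_space scale by fact
  let ?f = "\<lambda>u. \<Sum>v\<in>B. scale (u v) v"
  have "span B = ?f ` (B \<rightarrow>\<^sub>E UNIV)"
  proof (intro equalityI subsetI)
    fix x assume "x \<in> span B"
    then obtain u where "x = ?f u" unfolding span_finite[OF assms(2)] by (rule rangeE)
    also have "\<dots> = ?f (restrict u B)" by (rule sum.cong) simp_all
    finally show "x \<in> ?f ` (B \<rightarrow>\<^sub>E UNIV)" by (rule image_eqI[where x = "restrict u B"]) simp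
  next
    fix x assume "x \<in> ?f ` (B \<rightarrow>\<^sub>E UNIV)"
    then show "x \<in> span B" unfolding span_finite[OF assms(2)] by (rule subsetD[OF image_mono, OF subset_UNIV])
  qed
  moreover have "inj_on ?f (B \<rightarrow>\<^sub>E UNIV)"
  proof (rule inj_onI)
    fix u w assume uw: "u \<in> B \<rightarrow>\<^sub>E UNIV" "w \<in> B \<rightarrow>\<^sub>E UNIV" "?f u = ?f w"
    then have "(\<Sum>v\<in>B. scale (u v - w v) v) = 0"
      by (simp add: scale_left_diff_distrib sum_subtractf)
    then have "u v - w v = 0" if "v \<in> B" for v
      using independentD[OF assms(3,2) subset_refl, of "\<lambda>v. u v - w v"] that by blast
    then show "u = w" using uw by (intro PiE_ext) auto
  qed
  ultimately show ?thesis by (simp add: card_image card_PiE assms(2))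
qed

lemma card_subspace:
  fixes scale :: "'k::{finite,field} \<Rightarrow> 'b::{finite,ab_group_add} \<Rightarrow> 'b"
  assumes "vector_space scale" and "module.subspace scale S"
  shows "card S = CARD('k) ^ vector_space.dim scale S"
proof -
  interpret vector_space scale by fact
  obtain B where B: "B \<subseteq> S" "independent B" "S \<subseteq> span B" "card B = dim S"
    by (rule basis_exists)
  then have "span B = S" using assms(2) span_subspace by blast
  then show ?thesis using card_span_independent[OF assms(1) finite B(2)] B(4) by simp
qed

text \<open>
  The dimension theory of finite-dimensional spaces is developed relative to a fixed basis, and the
  $F_q$-structures do not come with a distinguished one.
\<close>

lemma ex_finite_dimensional:
  fixes scale :: "'k::field \<Rightarrow> 'b::{finite,ab_group_add} \<Rightarrow> 'b"
  assumes "vector_space scale"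
  obtains B where "finite_dimensional_vector_space scale B"
proof -
  interpret vector_space scale by fact
  obtain B where "B \<subseteq> UNIV" "independent B" "UNIV \<subseteq> span B" "card B = dim UNIV"
    by (rule basis_exists)
  then have "finite_dimensional_vector_space scale B"
    by unfold_locales (simp_all add: subset_antisym)
  then show ?thesis by (rule that)
qed

section \<open>Hyperplanes as orthogonal complements\<close>

lemma scalar_product_add_right:
  "scalar_product x (v + w) = scalar_product x v + scalar_product x w"
  by (simp add: scalar_product_def algebra_simps sum.distrib)

lemma scalar_product_scale_right:
  fixes x :: "'a::field ^ 'r"
  shows "scalar_product x (c *s v) = c * scalar_product x v"
  by (simp add: scalar_product_def sum_distrib_left ac_simps)

lemma scalar_product_sum_right:
  fixes x :: "'a::field ^ 'r"
  shows "scalar_product x (\<Sum>a\<in>A. f a) = (\<Sum>a\<in>A. scalar_product x (f a))"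
  unfolding scalar_product_def
  by (simp add: sum_distrib_left) (rule sum.swap)

lemma scalar_product_axis_right:
  fixes x :: "'a::field ^ 'r"
  shows "scalar_product x (axis i c) = x $ i * c"
proof -
  have "x $ j * axis i c $ j = (if j = i then x $ i * c else 0)" for j
    by (simp add: axis_def)
  then show ?thesis by (simp add: scalar_product_def)
qed

lemma subspace_orthogonal: "vec.subspace {v. scalar_product x v = (0::'a::field)}"
  by (rule vec.subspaceI)
     (simp_all add: scalar_product_add_right scalar_product_scale_right, simp add: scalar_product_def)

lemma hyperplane_iff: "hyperplane W \<longleftrightarrow> vec.subspace W \<and> vec.dim W + 1 = CARD('r)"
  for W :: "('a::field ^ 'r) set"
  by (auto simp: hyperplane_def proj_subspace_def)

text \<open>
  With \<open>e\<close> scaled so that its product with \<open>x\<close> is 1, every \<open>v\<close> differs from a multiple of \<open>e\<close> by a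
  vector orthogonal to \<open>x\<close>; hence the orthogonal complement has codimension one.
\<close>

lemma hyperplane_orthogonal:
  fixes x :: "'a::field ^ 'r"
  assumes "x \<noteq> 0"
  shows "hyperplane {v. scalar_product x v = 0}"
proof -
  let ?H = "{v. scalar_product x v = 0}"
  obtain i where i: "x $ i \<noteq> 0" using assms by (auto simp: vec_eq_iff)
  define e where "e = axis i (inverse (x $ i))"
  have e: "scalar_product x e = 1" using i by (simp add: e_def scalar_product_axis_right)
  have "v \<in> vec.span (insert e ?H)" for v
  proof -
    have "v - scalar_product x v *s e \<in> ?H"
      using scalar_product_add_right[of x "v - scalar_product x v *s e" "scalar_product x v *s e"]
      by (simp add: scalar_product_scale_right e)
    then show ?thesis unfolding vec.span_insert by (blast intro: vec.span_base)
  qed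
  then have "vec.dim (insert e ?H) = CARD('r)"
    by (metis UNIV_I equalityI subsetI vec.dim_UNIV card_cart_basis vec.dim_span)
  moreover have "vec.span ?H = ?H" using subspace_orthogonal by simp
  moreover have "e \<notin> ?H" using e by simp
  ultimately have "vec.dim ?H + 1 = CARD('r)"
    using vec.dim_insert[of e ?H] by simp
  then show ?thesis using subspace_orthogonal by (simp add: hyperplane_iff)
qed

text \<open>
  A linear functional that vanishes on \<open>H\<close> but not everywhere is a scalar product with some \<open>x\<close>; its
  kernel contains \<open>H\<close> and has the same dimension.
\<close>

lemma hyperplane_obtain_normal:
  fixes H :: "('a::field ^ 'r) set"
  assumes "hyperplane H"
  obtains x where "x \<noteq> 0" and "H = {v. scalar_product x v = 0}"
proof -
  have H: "vec.subspace H" "vec.dim H + 1 = CARD('r)" using assms by (auto simp: hyperplane_iff)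
  obtain B where B: "B \<subseteq> H" "vec.independent B" "H \<subseteq> vec.span B" by (meson vec.basis_exists)
  have spB: "vec.span B = H" using B H(1) vec.span_subspace by blast
  have "H \<noteq> UNIV" using H(2) vec.dim_UNIV card_cart_basis by (metis add_cancel_right_right one_neq_zero)
  then obtain e where e: "e \<notin> H" by blast
  have "vec.independent (insert e B)" using B(2) e spB by (simp add: vec.independent_insertI)
  \<comment> \<open>The functional is obtained as one coordinate of an endomorphism, whose matrix then supplies
    the normal vector as a row. The coordinate is arbitrary, hence \<open>undefined\<close>.\<close>
  then obtain g :: "'a ^ 'r \<Rightarrow> 'a ^ 'r" where g: "Vector_Spaces.linear (*s) (*s) g"
    "\<forall>v\<in>insert e B. g v = (if v = e then axis undefined 1 else 0)"
    using vec.linear_independent_extend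
      [of "insert e B" "\<lambda>v. if v = e then axis undefined 1 else 0"] by blast
  have eB: "e \<notin> B" using e B(1) by blast
  define x where "x = row undefined (matrix g)"
  have x: "scalar_product x v = g v $ undefined" for v
    using matrix_works[OF g(1), of v, symmetric]
    by (simp add: x_def row_def scalar_product_def matrix_vector_mult_def)
  have "g v = 0" if "v \<in> H" for v
  proof (rule vec.linear_eq_0_on_span[OF g(1)])
    show "g w = 0" if "w \<in> B" for w using g(2) eB that by auto
  qed (use that spB in simp)
  then have sub: "H \<subseteq> {v. scalar_product x v = 0}" by (auto simp: x)
  have "scalar_product x e = 1" using g(2) by (simp add: x)
  then have x0: "x \<noteq> 0" by (auto simp: scalar_product_def)
  have "vec.dim {v. scalar_product x v = 0} + 1 = CARD('r)"
    using hyperplane_orthogonal[OF x0] by (simp add: hyperplane_iff)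
  then have "H = {v. scalar_product x v = 0}"
    using vec.subspace_dim_equal[OF H(1) subspace_orthogonal sub] H(2) by simp
  with x0 show ?thesis by (rule that)
qed

section \<open>Independence in scattered subspaces\<close>

lemma span_Union_linear_set: "vec.span (\<Union> (linear_set U)) = vec.span U"
proof (rule vec.span_eq[THEN iffD2], intro conjI subsetI)
  fix x assume "x \<in> \<Union> (linear_set U)"
  then obtain u where "u \<in> U" "x \<in> vec.span {u}" by (auto simp: linear_set_def)
  then show "x \<in> vec.span U" using vec.span_mono[of "{u}" U] by blast
next
  fix u assume u: "u \<in> U"
  show "u \<in> vec.span (\<Union> (linear_set U))"
  proof (cases "u = 0")
    case False
    then have "vec.span {u} \<in> linear_set U" using u by (auto simp: linear_set_def)
    moreover have "u \<in> vec.span {u}" by (simp add: vec.span_base)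
    ultimately show ?thesis by (intro vec.span_base) blast
  qed (simp add: vec.span_zero)
qed

text \<open>
  The definition bounds the weight only of subspaces of dimension exactly \<open>h\<close>; the bound passes down
  to smaller ones. If \<open>W\<close> is proper, then \<open>U\<close>, which spans everything, contains some \<open>u\<close> outside
  \<open>W\<close>. Adding \<open>u\<close> to \<open>W\<close> raises the dimension by one and the weight by at least one, so an excess of
  weight over dimension would survive up to dimension \<open>h\<close>.
\<close>

lemma h_scattered_weight_le_dim:
  fixes \<iota> :: "'k::{finite,field} \<Rightarrow> 'a::{finite,field}" and U :: "('a ^ 'r) set"
  assumes "field_embedding \<iota>" and "h_scattered \<iota> h U" and "h \<le> CARD('r)"
    and "vec.subspace W" and "vec.dim W \<le> h"
  shows "linear_set_weight \<iota> U W \<le> vec.dim W"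
proof -
  interpret fq: vector_space "Fq_scale \<iota> :: 'k \<Rightarrow> 'a ^ 'r \<Rightarrow> 'a ^ 'r"
    by (rule vector_space_Fq_scale) fact
  obtain E where E: "finite_dimensional_vector_space (Fq_scale \<iota> :: 'k \<Rightarrow> 'a ^ 'r \<Rightarrow> 'a ^ 'r) E"
    using ex_finite_dimensional[OF fq.vector_space_axioms] .
  interpret fq: finite_dimensional_vector_space "Fq_scale \<iota> :: 'k \<Rightarrow> 'a ^ 'r \<Rightarrow> 'a ^ 'r" E by fact
  obtain d where "h = vec.dim W + d" using assms(5) le_Suc_ex by blast
  then show ?thesis using assms(4)
  proof (induction d arbitrary: W)
    case 0
    then show ?case using assms(2) by (auto simp: h_scattered_def proj_subspace_def)
  next
    case (Suc d)
    have "vec.dim W < CARD('r)" using Suc.prems assms(3) by simp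
    then have "W \<noteq> UNIV" using vec.dim_UNIV card_cart_basis by (metis less_irrefl)
    moreover have "vec.span U = UNIV"
      using assms(2) by (simp add: h_scattered_def span_Union_linear_set)
    ultimately have "\<not> U \<subseteq> W" using vec.span_minimal[OF _ Suc.prems(2), of U] by auto
    then obtain u where u: "u \<in> U" "u \<notin> W" by blast
    define W' where "W' = vec.span (insert u W)"
    have spW: "vec.span W = W" using Suc.prems(2) by simp
    have dW': "vec.dim W' = vec.dim W + 1"
      using u(2) unfolding W'_def vec.dim_span vec.dim_insert spW by simp
    have IH: "fq.dim (W' \<inter> U) \<le> vec.dim W + 1"
      using Suc.IH[of W'] Suc.prems(1) dW' by (simp add: W'_def linear_set_weight_def Fq_dim_def)
    obtain B where B: "B \<subseteq> W \<inter> U" "fq.independent B" "card B = fq.dim (W \<inter> U)"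
      by (meson fq.basis_exists)
    have "fq.subspace W"
      using Suc.prems(2) by (auto simp: vec.subspace_def fq.subspace_def Fq_scale_def)
    then have "fq.span B \<subseteq> W" using B(1) fq.span_minimal by blast
    then have "fq.independent (insert u B)" using u(2) B(2) fq.independent_insertI by blast
    moreover have "insert u B \<subseteq> W' \<inter> U"
      using u B(1) vec.span_superset[of "insert u W"] by (auto simp: W'_def)
    ultimately have "card (insert u B) \<le> fq.dim (W' \<inter> U)"
      by (metis fq.independent_card_le_dim)
    moreover have "u \<notin> B" using u(2) B(1) by blast
    ultimately show ?case using IH B(3) by (simp add: linear_set_weight_def Fq_dim_def)
  qed
qed

text \<open>
  This is the form in which scatteredness is used below: up to size \<open>h + 1\<close>, independence over $F_q$
  inside \<open>U\<close> implies independence over $F_{q^n}$, because a dependent set would span a subspace of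
  too large weight.
\<close>

lemma h_scattered_independent:
  fixes \<iota> :: "'k::{finite,field} \<Rightarrow> 'a::{finite,field}" and U :: "('a ^ 'r) set"
  assumes "field_embedding \<iota>" and "h_scattered \<iota> h U" and "h \<le> CARD('r)"
    and "S \<subseteq> U" and "\<not> module.dependent (Fq_scale \<iota>) S" and "card S \<le> h + 1"
  shows "vec.independent S"
proof -
  interpret fq: vector_space "Fq_scale \<iota> :: 'k \<Rightarrow> 'a ^ 'r \<Rightarrow> 'a ^ 'r"
    by (rule vector_space_Fq_scale) fact
  obtain E where E: "finite_dimensional_vector_space (Fq_scale \<iota> :: 'k \<Rightarrow> 'a ^ 'r \<Rightarrow> 'a ^ 'r) E"
    using ex_finite_dimensional[OF fq.vector_space_axioms] .
  interpret fq: finite_dimensional_vector_space "Fq_scale \<iota> :: 'k \<Rightarrow> 'a ^ 'r \<Rightarrow> 'a ^ 'r" E by fact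
  have "card S \<le> vec.dim (vec.span S)"
  proof (cases "vec.dim S \<le> h")
    case True
    have "card S \<le> fq.dim (vec.span S \<inter> U)"
      using assms(4,5) vec.span_superset[of S] by (intro fq.independent_card_le_dim) auto
    also have "\<dots> \<le> vec.dim (vec.span S)"
      using h_scattered_weight_le_dim[OF assms(1-3), of "vec.span S"] True
      by (simp add: linear_set_weight_def Fq_dim_def)
    finally show ?thesis .
  qed (use assms(6) in simp)
  then show ?thesis
    using vec.card_le_dim_spanning[of S "vec.span S"] vec.span_superset[of S] by simp
qed

section \<open>The weights of hyperplanes\<close>

text \<open>
  For independent $a_0, \ldots, a_h$ in $F_{q^n}$ over $F_q$, the space is the direct sum of the
  multiples $a_j U$. The map from $U^{h+1}$ that sends $(u_j)$ to the sum of the $a_j u_j$ is injective,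
  since the $F_q$-span of \<open>h + 1\<close> vectors of \<open>U\<close> has a basis that is independent over $F_{q^n}$ as
  well. By the maximality of the rank, domain and codomain have equally many elements.
\<close>

lemma maximum_h_scattered_decomposition:
  fixes \<iota> :: "'k::{finite,field} \<Rightarrow> 'a::{finite,field}" and U :: "('a ^ 'r) set"
  assumes emb: "field_embedding \<iota>" and "h_scattered \<iota> h U" and "h \<le> CARD('r)"
    and max: "card U ^ (h + 1) = CARD('a) ^ CARD('r)"
    and "\<not> module.dependent (\<lambda>c x. \<iota> c * x) A" and "card A = h + 1"
  obtains u where "\<And>a. a \<in> A \<Longrightarrow> u a \<in> U" and "v = (\<Sum>a\<in>A. a *s u a)"
proof -
  interpret fq: vector_space "Fq_scale \<iota> :: 'k \<Rightarrow> 'a ^ 'r \<Rightarrow> 'a ^ 'r"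
    by (rule vector_space_Fq_scale) fact
  interpret fqL: vector_space "\<lambda>c x. \<iota> c * x"
    by (rule vector_space_field_embedding) fact
  have subU: "fq.subspace U" using assms(2) by (simp add: h_scattered_def Fq_subspace_def)
  let ?f = "\<lambda>u. \<Sum>a\<in>A. a *s u a"
  \<comment> \<open>Expanding the \<open>w a\<close> in a basis \<open>B\<close> over $F_q$ turns the relation into one between elements of
    \<open>B\<close>, whose coefficients are $F_q$-combinations of \<open>A\<close>: both independences are used in turn.\<close>
  have kernel: "w a = 0"
    if w: "\<And>a. a \<in> A \<Longrightarrow> w a \<in> U" and zero: "?f w = 0" and a: "a \<in> A" for w a
  proof -
    obtain B where B: "B \<subseteq> w ` A" "fq.independent B" "w ` A \<subseteq> fq.span B"
      by (meson fq.basis_exists)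
    have "card B \<le> h + 1"
      using card_mono[OF _ B(1)] card_image_le[of A w] assms(6) by simp
    moreover have "B \<subseteq> U" using B(1) w by blast
    ultimately have indB: "vec.independent B"
      using h_scattered_independent[OF assms(1-3)] B(2) by blast
    have "\<exists>c. w a = (\<Sum>b\<in>B. \<iota> (c b) *s b)" if "a \<in> A" for a
    proof -
      have "w a \<in> fq.span B" using that B(3) by blast
      then show ?thesis unfolding fq.span_finite[OF finite] by (auto simp: Fq_scale_def)
    qed
    then obtain c where c: "\<And>a. a \<in> A \<Longrightarrow> w a = (\<Sum>b\<in>B. \<iota> (c a b) *s b)" by metis
    have "0 = (\<Sum>a\<in>A. a *s (\<Sum>b\<in>B. \<iota> (c a b) *s b))" using zero c by simp
    also have "\<dots> = (\<Sum>a\<in>A. \<Sum>b\<in>B. (\<iota> (c a b) * a) *s b)"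
      by (simp add: vec.scale_sum_right mult.commute)
    also have "\<dots> = (\<Sum>b\<in>B. (\<Sum>a\<in>A. \<iota> (c a b) * a) *s b)"
      by (subst sum.swap) (simp add: vec.scale_sum_left)
    finally have *: "(\<Sum>b\<in>B. (\<Sum>a\<in>A. \<iota> (c a b) * a) *s b) = 0" by simp
    have "(\<Sum>a\<in>A. \<iota> (c a b) * a) = 0" if "b \<in> B" for b
      using vec.independentD[OF indB finite subset_refl * that] .
    then have "c a b = 0" if "b \<in> B" for b
      using fqL.independentD[OF assms(5) finite subset_refl _ a, of "\<lambda>a. c a b"] that by simp
    then show ?thesis using c[OF a] field_embedding_eq_0_iff[OF emb, of 0] by simp
  qed
  have "inj_on ?f (A \<rightarrow>\<^sub>E U)"
  proof (rule inj_onI)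
    fix u w assume uw: "u \<in> A \<rightarrow>\<^sub>E U" "w \<in> A \<rightarrow>\<^sub>E U" "?f u = ?f w"
    have "?f (\<lambda>a. u a - w a) = 0"
      using uw(3) by (simp add: vec.scale_right_diff_distrib sum_subtractf)
    moreover have "u a - w a \<in> U" if "a \<in> A" for a
      using uw(1,2) that subU by (auto intro: fq.subspace_diff)
    ultimately have "u a - w a = 0" if "a \<in> A" for a
      using kernel[of "\<lambda>a. u a - w a"] that by blast
    then show "u = w" using uw by (intro PiE_ext) auto
  qed
  then have "card (?f ` (A \<rightarrow>\<^sub>E U)) = CARD('a ^ 'r)"
    using max assms(6) by (simp add: card_image card_PiE)
  then have "?f ` (A \<rightarrow>\<^sub>E U) = UNIV" by (intro card_subset_eq) auto
  then obtain u where "u \<in> A \<rightarrow>\<^sub>E U" "v = ?f u" by blast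
  then show ?thesis by (intro that[of u]) auto
qed

text \<open>
  Any nonzero functional does what the trace of the field extension is usually taken for.
\<close>

lemma ex_nonzero_functional:
  fixes \<iota> :: "'k::field \<Rightarrow> 'a::field"
  assumes "field_embedding \<iota>"
  obtains \<tau> :: "'a \<Rightarrow> 'k" and b where "\<And>x y. \<tau> (x + y) = \<tau> x + \<tau> y"
    and "\<And>c x. \<tau> (\<iota> c * x) = c * \<tau> x" and "\<tau> b \<noteq> 0"
proof -
  interpret fqL: vector_space "\<lambda>c x. \<iota> c * x"
    by (rule vector_space_field_embedding) fact
  obtain B where B: "B \<subseteq> UNIV" "fqL.independent B" "UNIV \<subseteq> fqL.span B"
      "card B = fqL.dim UNIV"
    by (rule fqL.basis_exists)
  have "B \<noteq> {}"
  proof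
    assume "B = {}"
    then have "(1::'a) \<in> {0}" using subsetD[OF B(3), of 1] by simp
    then show False by simp
  qed
  then obtain b where b: "b \<in> B" by blast
  have sp: "x \<in> fqL.span B" for x using B(3) by blast
  show ?thesis
  proof (rule that[of "\<lambda>x. fqL.representation B x b" b])
    show "fqL.representation B b b \<noteq> 0"
      using fqL.representation_basis[OF B(2) b] by simp
  qed (simp_all add: fqL.representation_add[OF B(2) sp sp] fqL.representation_scale[OF B(2) sp])
qed

text \<open>
  The elements \<open>a\<close> for which \<open>a T\<close> lies in the kernel of \<open>\<tau>\<close> are cut out by \<open>t\<close> linear conditions over
  $F_q$, one for each element of a basis of \<open>T\<close>. They form a subspace of dimension at least \<open>n - t\<close>.
\<close>

lemma ex_independent_annihilators:
  fixes \<iota> :: "'k::{finite,field} \<Rightarrow> 'a::{finite,field}"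
  assumes emb: "field_embedding \<iota>" and card: "CARD('a) = CARD('k) ^ n"
    and sub: "module.subspace (\<lambda>c x. \<iota> c * x) T"
    and cardT: "card T = CARD('k) ^ t" and "t + m \<le> n"
    and add: "\<And>x y. \<tau> (x + y) = \<tau> x + \<tau> y"
    and scale: "\<And>c x. \<tau> (\<iota> c * x) = c * \<tau> x"
  obtains A where "\<not> module.dependent (\<lambda>c x. \<iota> c * x) A" and "card A = m"
    and "\<And>a s. a \<in> A \<Longrightarrow> s \<in> T \<Longrightarrow> \<tau> (a * s) = 0"
proof -
  let ?s = "\<lambda>c x. \<iota> c * x"
  interpret fqL: vector_space ?s
    by (rule vector_space_field_embedding) fact
  have q: "1 < CARD('k)" by (rule card_finite_field)
  obtain B where B: "B \<subseteq> T" "fqL.independent B" "T \<subseteq> fqL.span B" "card B = fqL.dim T"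
    by (rule fqL.basis_exists)
  have "CARD('k) ^ card B = CARD('k) ^ t"
    using card_subspace[OF fqL.vector_space_axioms sub] cardT B(4) by simp
  then have cardB: "card B = t" using q by simp
  interpret \<tau>: additive \<tau> by unfold_locales (rule add)
  define K where "K = {a. \<forall>s\<in>B. \<tau> (a * s) = 0}"
  have subK: "fqL.subspace K"
    by (rule fqL.subspaceI) (simp_all add: K_def \<tau>.zero add scale distrib_right mult.assoc)
  let ?f = "\<lambda>a. restrict (\<lambda>s. \<tau> (a * s)) B"
  have "CARD('a) = card (range ?f) * card K"
  proof (rule card_eq_card_image_times_card_fibre)
    fix x y :: 'a
    have "?f x = ?f y \<longleftrightarrow> (\<forall>s\<in>B. \<tau> (x * s) = \<tau> (y * s))"
      by (auto simp: restrict_def fun_eq_iff)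
    also have "\<dots> \<longleftrightarrow> - y + x \<in> K"
      by (simp add: K_def left_diff_distrib \<tau>.diff)
    finally show "?f x = ?f y \<longleftrightarrow> - y + x \<in> K" .
  qed auto
  also have "card (range ?f) \<le> card (B \<rightarrow>\<^sub>E (UNIV::'k set))"
    by (rule card_mono) (auto intro: finite_PiE)
  also have "\<dots> = CARD('k) ^ t" by (simp add: card_PiE cardB)
  also have "card K = CARD('k) ^ fqL.dim K"
    by (rule card_subspace) (use subK fqL.vector_space_axioms in auto)
  finally have "CARD('k) ^ n \<le> CARD('k) ^ (t + fqL.dim K)"
    by (simp add: card power_add)
  then have "m \<le> fqL.dim K" using q assms(5) by simp
  moreover obtain D where D: "D \<subseteq> K" "fqL.independent D" "card D = fqL.dim K"
    by (rule fqL.basis_exists)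
  ultimately obtain A where A: "A \<subseteq> D" "card A = m"
    by (metis obtain_subset_with_card_n)
  show ?thesis
  proof (rule that)
    show "fqL.independent A" using fqL.independent_mono D(2) A(1) .
    fix a s assume as: "a \<in> A" "s \<in> T"
    have "a \<in> K" using as(1) A(1) D(1) by blast
    have "\<tau> (a * (\<iota> c * s)) = c * \<tau> (a * s)" for c s
      using scale[of c "a * s"] by (simp only: mult.left_commute)
    then have "fqL.subspace {s. \<tau> (a * s) = 0}"
      by (intro fqL.subspaceI) (simp_all add: \<tau>.zero add distrib_left)
    moreover have "B \<subseteq> {s. \<tau> (a * s) = 0}" using \<open>a \<in> K\<close> by (auto simp: K_def)
    ultimately show "\<tau> (a * s) = 0" using fqL.span_minimal B(3) as(2) by blast
  qed fact
qed

lemma scalar_product_image_subspace: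
  fixes \<iota> :: "'k::field \<Rightarrow> 'a::field" and U :: "('a ^ 'r) set"
  assumes emb: "field_embedding \<iota>" and sub: "Fq_subspace \<iota> U"
  shows "module.subspace (\<lambda>c x. \<iota> c * x) (scalar_product x ` U)"
proof -
  interpret fq: vector_space "Fq_scale \<iota> :: 'k \<Rightarrow> 'a ^ 'r \<Rightarrow> 'a ^ 'r"
    by (rule vector_space_Fq_scale) fact
  interpret fqL: vector_space "\<lambda>c x. \<iota> c * x"
    by (rule vector_space_field_embedding) fact
  interpret lin: Vector_Spaces.linear "Fq_scale \<iota> :: 'k \<Rightarrow> 'a ^ 'r \<Rightarrow> 'a ^ 'r"
      "\<lambda>c x. \<iota> c * x" "scalar_product x"
    by unfold_locales
      (simp_all add: Fq_scale_def scalar_product_add_right scalar_product_scale_right)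
  show ?thesis using lin.subspace_image sub by (simp add: Fq_subspace_def)
qed

lemma card_eq_card_image_times_hyperplane_part:
  fixes \<iota> :: "'k::{finite,field} \<Rightarrow> 'a::{finite,field}" and U :: "('a ^ 'r) set"
  assumes emb: "field_embedding \<iota>" and sub: "Fq_subspace \<iota> U"
  shows "card U = card (scalar_product x ` U) *
    CARD('k) ^ linear_set_weight \<iota> U {v. scalar_product x v = 0}"
proof -
  let ?H = "{v. scalar_product x v = 0}"
  interpret fq: vector_space "Fq_scale \<iota> :: 'k \<Rightarrow> 'a ^ 'r \<Rightarrow> 'a ^ 'r"
    by (rule vector_space_Fq_scale) fact
  interpret additive "scalar_product x" by unfold_locales (rule scalar_product_add_right)
  have subU: "fq.subspace U" using sub by (simp add: Fq_subspace_def)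
  have "fq.subspace ?H"
    by (rule fq.subspaceI)
      (simp_all add: zero Fq_scale_def scalar_product_add_right scalar_product_scale_right)
  then have "fq.subspace (?H \<inter> U)" using subU by (rule fq.subspace_inter)
  then have "card (?H \<inter> U) = CARD('k) ^ linear_set_weight \<iota> U ?H"
    by (simp add: card_subspace[OF fq.vector_space_axioms] linear_set_weight_def Fq_dim_def)
  moreover have "card U = card (scalar_product x ` U) * card (?H \<inter> U)"
  proof (rule card_eq_card_image_times_card_fibre)
    fix v w assume "v \<in> U" "w \<in> U"
    then have "- w + v \<in> U" using fq.subspace_diff[OF subU] by simp
    then show "scalar_product x v = scalar_product x w \<longleftrightarrow> - w + v \<in> ?H \<inter> U"
      by (simp add: diff)
  qed (use subU fq.subspace_add in auto)
  ultimately show ?thesis by simp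
qed

text \<open>
  If the image of \<open>U\<close> under the functional given by \<open>x\<close> were smaller, there would be \<open>h + 1\<close>
  independent elements \<open>a\<close> that multiply it into the kernel of a nonzero \<open>\<tau>\<close>. As the whole space is
  the sum of the \<open>a U\<close>, the values of \<open>x\<close> on the whole space would lie in that kernel too, whereas
  \<open>x\<close> takes every value.
\<close>

lemma maximum_h_scattered_image_ge:
  fixes \<iota> :: "'k::{finite,field} \<Rightarrow> 'a::{finite,field}" and U :: "('a ^ 'r) set"
  assumes emb: "field_embedding \<iota>" and scat: "h_scattered \<iota> h U" and h: "h \<le> CARD('r)"
    and n: "CARD('a) = CARD('k) ^ n"
    and max: "card U ^ (h + 1) = CARD('a) ^ CARD('r)"
    and x: "x \<noteq> 0" and t: "card (scalar_product x ` U) = CARD('k) ^ t"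
  shows "n \<le> t + h"
proof (rule ccontr)
  assume "\<not> n \<le> t + h"
  then have small: "t + (h + 1) \<le> n" by simp
  have "Fq_subspace \<iota> U" using scat by (simp add: h_scattered_def)
  note sub = scalar_product_image_subspace[OF emb this, of x]
  obtain \<tau> :: "'a \<Rightarrow> 'k" and b where \<tau>: "\<And>x y. \<tau> (x + y) = \<tau> x + \<tau> y"
    "\<And>c x. \<tau> (\<iota> c * x) = c * \<tau> x" "\<tau> b \<noteq> 0"
    using ex_nonzero_functional[OF emb] by metis
  obtain A where A: "\<not> module.dependent (\<lambda>c x. \<iota> c * x) A" "card A = h + 1"
    "\<And>a s. a \<in> A \<Longrightarrow> s \<in> scalar_product x ` U \<Longrightarrow> \<tau> (a * s) = 0"
    using ex_independent_annihilators[OF emb n sub t small, of \<tau>] \<tau>(1,2) by metis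
  obtain i where i: "x $ i \<noteq> 0" using x by (auto simp: vec_eq_iff)
  define v where "v = axis i (b / x $ i)"
  have xv: "scalar_product x v = b" using i by (simp add: v_def scalar_product_axis_right)
  obtain u where u: "\<And>a. a \<in> A \<Longrightarrow> u a \<in> U" "v = (\<Sum>a\<in>A. a *s u a)"
    using maximum_h_scattered_decomposition[OF emb scat h max A(1,2), of v] by blast
  interpret \<tau>: additive \<tau> by unfold_locales (rule \<tau>(1))
  have "\<tau> b = (\<Sum>a\<in>A. \<tau> (a * scalar_product x (u a)))"
    unfolding xv[symmetric] u(2)
    by (simp add: scalar_product_sum_right scalar_product_scale_right \<tau>.sum)
  also have "\<dots> = 0" using A(3) u(1) by (intro sum.neutral) blast
  finally show False using \<tau>(3) by simp
qed

text \<open>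
  The image of \<open>U\<close> under the functional of a hyperplane has dimension \<open>t\<close> between \<open>n - h\<close> and \<open>n\<close>, and
  its kernel on \<open>U\<close> has the complementary dimension.
\<close>

lemma maximum_h_scattered_weight_set:
  fixes \<iota> :: "'k::{finite,field} \<Rightarrow> 'a::{finite,field}" and U :: "('a ^ 'r) set"
  assumes emb: "field_embedding \<iota>" and scat: "h_scattered \<iota> h U" and h: "h \<le> CARD('r)"
    and n: "CARD('a) = CARD('k) ^ n"
    and rank: "Fq_dim \<iota> U * (h + 1) = CARD('r) * n"
  shows "linear_set_weight \<iota> U ` {H. hyperplane H} \<subseteq> (\<lambda>t. Fq_dim \<iota> U - t) ` {n - h..n}"
proof clarify
  let ?q = "CARD('k)"
  fix H :: "('a ^ 'r) set" assume "hyperplane H"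
  then obtain x where x: "x \<noteq> 0" "H = {v. scalar_product x v = 0}"
    by (rule hyperplane_obtain_normal)
  have q: "1 < ?q" by (rule card_finite_field)
  have sub: "Fq_subspace \<iota> U" using scat by (simp add: h_scattered_def)
  have cU: "card U = ?q ^ Fq_dim \<iota> U"
    using card_subspace[OF vector_space_Fq_scale[OF emb]] sub
    by (simp add: Fq_subspace_def Fq_dim_def)
  define t where "t = vector_space.dim (\<lambda>c x. \<iota> c * x) (scalar_product x ` U)"
  have t: "card (scalar_product x ` U) = ?q ^ t"
    unfolding t_def
    by (rule card_subspace[OF vector_space_field_embedding[OF emb]
          scalar_product_image_subspace[OF emb sub]])
  have "?q ^ Fq_dim \<iota> U = ?q ^ (t + linear_set_weight \<iota> U H)"
    using card_eq_card_image_times_hyperplane_part[OF emb sub, of x] x(2)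
    by (simp add: t cU power_add)
  then have k: "Fq_dim \<iota> U = t + linear_set_weight \<iota> U H" using q by simp
  have "card U ^ (h + 1) = CARD('a) ^ CARD('r)"
    unfolding cU n power_mult[symmetric] using rank by (simp add: mult.commute)
  then have "n \<le> t + h" using maximum_h_scattered_image_ge[OF emb scat h n _ x(1) t] by blast
  moreover have "?q ^ t \<le> ?q ^ n"
    unfolding t[symmetric] n[symmetric] by (rule card_mono) auto
  then have "t \<le> n" using q by simp
  ultimately show "linear_set_weight \<iota> U H \<in> (\<lambda>t. Fq_dim \<iota> U - t) ` {n - h..n}"
    using k by (intro image_eqI[of _ _ t]) auto
qed

section \<open>The number of points\<close>

text \<open>
  Every point has weight one: otherwise it would contain two vectors of \<open>U\<close> that are independent
  over $F_q$ but not over $F_{q^n}$.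
\<close>

lemma h_scattered_point_in_Fq_line:
  fixes \<iota> :: "'k::{finite,field} \<Rightarrow> 'a::{finite,field}" and U :: "('a ^ 'r) set"
  assumes emb: "field_embedding \<iota>" and scat: "h_scattered \<iota> h U" and h: "h \<le> CARD('r)" "0 < h"
    and uv: "u \<in> U" "v \<in> U" "u \<noteq> 0" "v \<in> vec.span {u}"
  shows "v \<in> range (\<lambda>c. Fq_scale \<iota> c u)"
proof (rule ccontr)
  assume v: "v \<notin> range (\<lambda>c. Fq_scale \<iota> c u)"
  interpret fq: vector_space "Fq_scale \<iota> :: 'k \<Rightarrow> 'a ^ 'r \<Rightarrow> 'a ^ 'r"
    by (rule vector_space_Fq_scale) fact
  have "v \<notin> fq.span {u}" using v by (simp add: fq.span_singleton)
  then have "fq.independent (insert v {u})" and "v \<noteq> u"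
    using uv(3) fq.span_base[of u "{u}"] fq.independent_insertI[of v "{u}"] by auto
  moreover have "card {v, u} \<le> h + 1" using h(2) card_insert_le_m1[of 2 "{u}" v] by simp
  ultimately have "vec.independent (insert v {u})"
    using uv h_scattered_independent[OF emb scat h(1), of "{v, u}"] by simp
  then show False using vec.independent_insert[of v "{u}"] \<open>v \<noteq> u\<close> uv(4) by simp
qed

lemma span_singleton_eq:
  fixes u v :: "'a::field ^ 'r"
  assumes "v \<in> vec.span {u}" and "v \<noteq> 0"
  shows "vec.span {v} = vec.span {u}"
proof -
  obtain c where c: "v = c *s u" using assms(1) by (auto simp: vec.span_singleton)
  then have "u = inverse c *s v" using assms(2) by auto
  then have "u \<in> vec.span {v}" by (auto simp: vec.span_singleton)
  then show ?thesis using assms(1) by (simp add: vec.span_eq)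
qed

text \<open>
  Each point is represented by the \<open>q - 1\<close> nonzero $F_q$-multiples of any of its vectors in \<open>S\<close>.
\<close>

lemma card_linear_set:
  fixes \<iota> :: "'k::{finite,field} \<Rightarrow> 'a::{finite,field}" and S :: "('a ^ 'r) set"
  assumes emb: "field_embedding \<iota>" and sub: "Fq_subspace \<iota> S"
    and points: "\<And>u v. u \<in> S \<Longrightarrow> v \<in> S \<Longrightarrow> u \<noteq> 0 \<Longrightarrow> v \<in> vec.span {u} \<Longrightarrow> v \<in> range (\<lambda>c. Fq_scale \<iota> c u)"
  shows "real (card (linear_set S)) = theta CARD('k) (int (Fq_dim \<iota> S) - 1)"
proof -
  let ?q = "CARD('k)"
  interpret fq: vector_space "Fq_scale \<iota> :: 'k \<Rightarrow> 'a ^ 'r \<Rightarrow> 'a ^ 'r"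
    by (rule vector_space_Fq_scale) fact
  have S: "fq.subspace S" using sub by (simp add: Fq_subspace_def)
  let ?p = "\<lambda>u. vec.span {u}"
  have img: "linear_set S = ?p ` (S - {0})" by (auto simp: linear_set_def)
  have "card (S - {0}) = (\<Sum>P\<in>linear_set S. card {v \<in> S - {0}. ?p v = P})"
    using sum.image_gen[of "S - {0}" "\<lambda>_. 1" ?p, OF finite] unfolding img by (simp only: card_eq_sum)
  also have "\<dots> = (\<Sum>P\<in>linear_set S. ?q - 1)"
  proof (rule sum.cong)
    fix P assume "P \<in> linear_set S"
    then obtain u where u: "u \<in> S" "u \<noteq> 0" "P = ?p u" by (auto simp: linear_set_def)
    have "{v \<in> S - {0}. ?p v = P} = (\<lambda>c. Fq_scale \<iota> c u) ` (UNIV - {0})"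
    proof (intro equalityI subsetI)
      fix v assume v: "v \<in> {v \<in> S - {0}. ?p v = P}"
      then have "v \<in> ?p u" using vec.span_base[of v "{v}"] u(3) by simp
      then obtain c where c: "v = Fq_scale \<iota> c u" using points[OF u(1) _ u(2)] v by blast
      moreover have "c \<noteq> 0" using v c by auto
      ultimately show "v \<in> (\<lambda>c. Fq_scale \<iota> c u) ` (UNIV - {0})" by blast
    next
      fix v assume "v \<in> (\<lambda>c. Fq_scale \<iota> c u) ` (UNIV - {0})"
      then obtain c where c: "c \<noteq> 0" "v = Fq_scale \<iota> c u" by auto
      then have "v \<noteq> 0" "v \<in> S" using u(1,2) fq.subspace_scale[OF S] by auto
      moreover have "?p v = ?p u"
        using \<open>v \<noteq> 0\<close> c(2) by (intro span_singleton_eq) (auto simp: vec.span_singleton Fq_scale_def)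
      ultimately show "v \<in> {v \<in> S - {0}. ?p v = P}" using u(3) by simp
    qed
    moreover have "inj_on (\<lambda>c. Fq_scale \<iota> c u) (UNIV - {0})"
      using u(2) by (auto intro: inj_onI)
    ultimately show "card {v \<in> S - {0}. ?p v = P} = ?q - 1"
      by (simp add: card_image card_Diff_subset)
  qed simp
  finally have "card S - 1 = card (linear_set S) * (?q - 1)"
    using fq.subspace_0[OF S] by (simp add: card_Diff_subset)
  moreover have "card S = ?q ^ Fq_dim \<iota> S"
    using card_subspace[OF fq.vector_space_axioms S] by (simp add: Fq_dim_def)
  ultimately have "?q ^ Fq_dim \<iota> S - 1 = card (linear_set S) * (?q - 1)" by simp
  then have "real (?q ^ Fq_dim \<iota> S - 1) = real (card (linear_set S) * (?q - 1))" by simp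
  then have "real ?q ^ Fq_dim \<iota> S - 1 = real (card (linear_set S)) * (real ?q - 1)"
    using card_finite_field[where 'k = 'k] by simp
  then show ?thesis using card_finite_field[where 'k = 'k] by (simp add: theta_def field_simps)
qed

section \<open>The code\<close>

lemma vector_matrix_mult_nth:
  "(x v* G) $ i = scalar_product x (column i G)"
  by (simp add: vector_matrix_mult_def scalar_product_def column_def)

lemma scalar_product_eq_0_on_point:
  fixes x :: "'a::field ^ 'r"
  shows "vec.span {u} \<subseteq> {v. scalar_product x v = 0} \<longleftrightarrow> scalar_product x u = 0"
proof
  assume "vec.span {u} \<subseteq> {v. scalar_product x v = 0}"
  then show "scalar_product x u = 0" using vec.span_base[of u "{u}"] by blast
next
  assume "scalar_product x u = 0"
  then show "vec.span {u} \<subseteq> {v. scalar_product x v = 0}"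
    by (intro vec.span_minimal subspace_orthogonal) simp
qed

text \<open>
  The zero entries of the codeword of \<open>x\<close> are at the points orthogonal to \<open>x\<close>, which form the linear
  set of the intersection of \<open>U\<close> with the hyperplane.
\<close>

lemma hamming_weight_codeword:
  fixes G :: "'a::{finite,field} ^ 'c ^ 'r"
  assumes G: "generator_matrix_of U G"
  shows "hamming_weight (x v* G) + card (linear_set ({v. scalar_product x v = 0} \<inter> U)) = CARD('c)"
proof -
  let ?H = "{v. scalar_product x v = 0}" and ?p = "\<lambda>i. vec.span {column i G}"
  let ?Z = "{i. (x v* G) $ i = 0}"
  have bij: "inj ?p" "range ?p = linear_set U"
    using G by (auto simp: generator_matrix_of_def bij_betw_def)
  have "linear_set (?H \<inter> U) = {P \<in> linear_set U. P \<subseteq> ?H}"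
    using scalar_product_eq_0_on_point[of _ x] by (auto simp: linear_set_def)
  also have "\<dots> = ?p ` ?Z"
    unfolding bij(2)[symmetric] using scalar_product_eq_0_on_point[of _ x]
    by (auto simp: vector_matrix_mult_nth)
  finally have "card (linear_set (?H \<inter> U)) = card ?Z"
    using bij(1) by (simp add: card_image inj_on_subset)
  moreover have "hamming_weight (x v* G) + card ?Z = card ({i. (x v* G) $ i \<noteq> 0} \<union> ?Z)"
    unfolding hamming_weight_def by (subst card_Un_disjoint) auto
  moreover have "{i. (x v* G) $ i \<noteq> 0} \<union> ?Z = UNIV" by blast
  ultimately show ?thesis by simp
qed

text \<open>
  If all columns are orthogonal to \<open>x\<close>, so is \<open>U\<close>, and hence the whole space that it spans.
\<close>

lemma encoding_inj:
  fixes G :: "'a::{finite,field} ^ 'c ^ 'r"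
  assumes G: "generator_matrix_of U G" and span: "vec.span U = UNIV" and "x v* G = 0"
  shows "x = 0"
proof (rule ccontr)
  assume "x \<noteq> 0"
  then have "hyperplane {v. scalar_product x v = 0}" by (rule hyperplane_orthogonal)
  moreover have "U \<subseteq> {v. scalar_product x v = 0}"
  proof
    fix u assume u: "u \<in> U"
    show "u \<in> {v. scalar_product x v = 0}"
    proof (cases "u = 0")
      case False
      then have "vec.span {u} \<in> linear_set U" using u by (auto simp: linear_set_def)
      then obtain i where i: "vec.span {u} = vec.span {column i G}"
        using G by (auto simp: generator_matrix_of_def bij_betw_def)
      have "scalar_product x (column i G) = 0"
        using vector_matrix_mult_nth[of x G i] assms(3) by simp
      then show ?thesis
        using scalar_product_eq_0_on_point[of u x] scalar_product_eq_0_on_point[of "column i G" x] i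
        by simp
    qed (simp add: scalar_product_def)
  qed
  then have "{v. scalar_product x v = 0} = UNIV"
    using vec.span_minimal[OF _ subspace_orthogonal[of x], of U] span by blast
  ultimately have "vec.dim (UNIV :: ('a ^ 'r) set) + 1 = CARD('r)" by (simp add: hyperplane_iff)
  then show False by (metis add_cancel_right_right card_cart_basis one_neq_zero vec.dim_UNIV)
qed

lemma code_of_subspace_dim:
  fixes G :: "'a::{finite,field} ^ 'c ^ 'r"
  assumes "generator_matrix_of U G" and "vec.span U = UNIV"
  shows "vec.subspace (code_of G)" and "vec.dim (code_of G) = CARD('r)"
proof -
  have C: "code_of G = range ((*v) (transpose G))" by (auto simp: code_of_def)
  have lin: "Vector_Spaces.linear (*s) (*s) ((*v) (transpose G))" by (rule matrix_vector_mul_linear_gen)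
  show "vec.subspace (code_of G)"
    unfolding C by (rule vec.linear_subspace_image[OF lin vec.subspace_UNIV])
  have "inj ((*v) (transpose G))"
    unfolding vec.linear_inj_iff_eq_0[OF lin] using encoding_inj[OF assms] by simp
  then have "vec.dim (code_of G) = vec.dim (UNIV :: ('a ^ 'r) set)"
    unfolding C by (intro vec.dim_image_eq[OF lin]) simp
  then show "vec.dim (code_of G) = CARD('r)" by (simp only: vec.dim_UNIV card_cart_basis)
qed

theorem theorem4p1:
  fixes \<iota> :: "'k::{finite,field} \<Rightarrow> 'a::{finite,field}"
    and U :: "('a ^ 'r) set"
    and G :: "'a ^ 'c ^ 'r"
    and q n r h N :: nat
  assumes "CARD('k) = q" and "CARD('a) = q ^ n" and "field_embedding \<iota>"
    and "CARD('r) = r"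
    and "0 < n" and "0 < r" and "0 < h" and "h \<le> r - 1" and "h + 1 dvd r * n"
    and "maximum_h_scattered \<iota> n h U"
    and "generator_matrix_of U G"
    and "N = card (linear_set U)"
  shows "CARD('c) = N \<and>
         real N = (real q ^ (r * n div (h + 1)) - 1) / (real q - 1) \<and>
         vec.subspace (code_of G) \<and> vec.dim (code_of G) = r \<and>
         card (code_weights (code_of G)) \<le> h + 1 \<and>
         real ` code_weights (code_of G) =
           {real N - theta q (int i - 1) | i.
              i \<in> {linear_set_weight \<iota> U H | H. hyperplane H}}"
proof -
  let ?orth = "\<lambda>x :: 'a ^ 'r. {v. scalar_product x v = 0}"
  let ?W = "linear_set_weight \<iota> U ` {H. hyperplane H}"
  let ?wt = "\<lambda>i. real N - theta q (int i - 1)"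
  note emb = assms(3)
  interpret fq: vector_space "Fq_scale \<iota> :: 'k \<Rightarrow> 'a ^ 'r \<Rightarrow> 'a ^ 'r"
    by (rule vector_space_Fq_scale) fact
  have scat: "h_scattered \<iota> h U" and hr: "h \<le> CARD('r)"
    using assms(4,8,10) by (auto simp: maximum_h_scattered_def)
  have sub: "Fq_subspace \<iota> U" and span: "vec.span U = UNIV"
    using scat by (auto simp: h_scattered_def span_Union_linear_set)
  have "real (Fq_dim \<iota> U) * real (h + 1) = real (r * n)"
    using assms(4,10) by (simp add: maximum_h_scattered_def field_simps)
  then have rank: "Fq_dim \<iota> U * (h + 1) = r * n"
    by (simp only: of_nat_mult[symmetric] of_nat_eq_iff)
  then have k: "r * n div (h + 1) = Fq_dim \<iota> U" by (metis add_is_0 nonzero_mult_div_cancel_right one_neq_zero)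
  have points: "v \<in> range (\<lambda>c. Fq_scale \<iota> c u)"
    if "u \<in> U" "v \<in> U" "u \<noteq> 0" "v \<in> vec.span {u}" for u v
    using h_scattered_point_in_Fq_line[OF emb scat hr assms(7) that] .
  have N: "CARD('c) = N"
    using assms(11,12) bij_betw_same_card unfolding generator_matrix_of_def by blast
  have N': "real N = (real q ^ (r * n div (h + 1)) - 1) / (real q - 1)"
    using card_linear_set[OF emb sub] points unfolding k assms(12)
    by (simp add: theta_def assms(1))
  have wt: "real (hamming_weight (x v* G)) = ?wt (linear_set_weight \<iota> U (?orth x))" for x
  proof -
    have "fq.subspace (?orth x)"
      using subspace_orthogonal[of x] by (auto simp: vec.subspace_def fq.subspace_def Fq_scale_def)
    then have "Fq_subspace \<iota> (?orth x \<inter> U)"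
      using sub by (simp add: Fq_subspace_def fq.subspace_inter)
    then have "real (card (linear_set (?orth x \<inter> U))) =
        theta q (int (linear_set_weight \<iota> U (?orth x)) - 1)"
      unfolding linear_set_weight_def assms(1)[symmetric]
      by (rule card_linear_set[OF emb]) (use points in auto)
    then show ?thesis using hamming_weight_codeword[OF assms(11), of x] N by linarith
  qed
  have "code_of G - {0} = (\<lambda>x. x v* G) ` (UNIV - {0})"
    using encoding_inj[OF assms(11) span] by (auto simp: code_of_def)
  then have "real ` code_weights (code_of G) =
      (\<lambda>x. ?wt (linear_set_weight \<iota> U (?orth x))) ` (UNIV - {0})"
    by (simp add: code_weights_def image_image wt)
  also have "\<dots> = ?wt ` linear_set_weight \<iota> U ` ?orth ` (UNIV - {0})"
    by (simp add: image_image)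
  also have "?orth ` (UNIV - {0}) = {H. hyperplane H}"
  proof (intro equalityI subsetI)
    fix H :: "('a ^ 'r) set" assume "H \<in> {H. hyperplane H}"
    then obtain x where "x \<noteq> 0" "H = ?orth x" using hyperplane_obtain_normal by blast
    then show "H \<in> ?orth ` (UNIV - {0})" by blast
  qed (use hyperplane_orthogonal in auto)
  finally have weights: "real ` code_weights (code_of G) = ?wt ` ?W" .
  have finite: "finite {n - h..n}" by simp
  have "card (code_weights (code_of G)) = card (?wt ` ?W)"
    unfolding weights[symmetric] by (simp add: card_image)
  also have "\<dots> \<le> card (?wt ` (\<lambda>t. Fq_dim \<iota> U - t) ` {n - h..n})"
    using maximum_h_scattered_weight_set[OF emb scat hr, of n] assms(1,2,4) rank
    by (intro card_mono image_mono) auto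
  also have "\<dots> \<le> card {n - h..n}"
    by (meson card_image_le finite finite_imageI order_trans)
  also have "\<dots> \<le> h + 1" by simp
  finally have "card (code_weights (code_of G)) \<le> h + 1" .
  moreover have "{?wt i | i. i \<in> {linear_set_weight \<iota> U H | H. hyperplane H}} = ?wt ` ?W"
    by blast
  ultimately show ?thesis
    using N N' weights code_of_subspace_dim[OF assms(11) span] assms(4) by simp
qed

end
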